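(* Let $\mathbb{F}_q$ be a finite field, let $f\in\mathbb{F}_q[x]$ be a nonzero monic polynomial, and let $D=\{f_1,f_2,\ldots,f_k\}$ be a set of monic divisors of $f$. Suppose that the following conditions hold: (1) $\deg(f_i)\ge 1$ for all $i$; (2) $\gcd(f_i,f_j)=1$ for all $i\neq j$; (3) $k\ge 3$; (4) $\mathbb{F}_q\neq\mathbb{F}_2$. Then the gcd-graph $G_f(D)$ is not a perfect graph.
   Context: All polynomials are monic unless stated otherwise and gcd's are taken monic (so $\gcd(0,f)=f$). The gcd-graph $G_f(D)$ is the undirected graph with vertex set the ring $\mathbb{F}_q[x]/(f)$ in which two vertices $u,v$ are adjacent if and only if $\gcd(u-v,f)\in D$ (here it is loopless, since the hypotheses force $f\notin D$). A graph is perfect if for every induced subgraph $H$ the chromatic number of $H$ equals the size of its maximum clique. *)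

theory Defs
  imports
    "HOL-Library.Cardinality"
    "HOL-Computational_Algebra.Computational_Algebra"
    "Graph_Theory.Graph_Theory"
begin

section \<open>Perfect graphs\<close>

text \<open>
  As in the library, an undirected graph is a symmetric digraph (locale \<^locale>\<open>graph\<close>).
\<close>

definition proper_colouring :: "('v, 'e) pre_digraph \<Rightarrow> ('v \<Rightarrow> nat) \<Rightarrow> nat \<Rightarrow> bool" where
  "proper_colouring G c k \<longleftrightarrow>
     c ` verts G \<subseteq> {..<k} \<and> (\<forall>u v. u \<rightarrow>\<^bsub>G\<^esub> v \<longrightarrow> c u \<noteq> c v)"

definition chromatic_number :: "('v, 'e) pre_digraph \<Rightarrow> nat" where
  "chromatic_number G = (LEAST k. \<exists>c. proper_colouring G c k)"

definition clique :: "('v, 'e) pre_digraph \<Rightarrow> 'v set \<Rightarrow> bool" where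
  "clique G K \<longleftrightarrow> K \<subseteq> verts G \<and> (\<forall>u\<in>K. \<forall>v\<in>K. u \<noteq> v \<longrightarrow> u \<rightarrow>\<^bsub>G\<^esub> v)"

definition clique_number :: "('v, 'e) pre_digraph \<Rightarrow> nat" where
  "clique_number G = Max (card ` {K. clique G K})"

text \<open>
  Intended for finite loopless graphs only: otherwise the minimum or the maximum above
  need not exist.
\<close>

definition perfect_graph :: "('v, 'e) pre_digraph \<Rightarrow> bool" where
  "perfect_graph G \<longleftrightarrow>
     (\<forall>H. induced_subgraph H G \<longrightarrow> chromatic_number H = clique_number H)"

section \<open>The gcd-graph of a polynomial\<close>

text \<open>
  The class \<^class>\<open>field_gcd\<close> is what the library requires for gcds of polynomials over a field.
  It does not restrict the field: every field carries the additional operations, with all nonzero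
  elements as units. The gcd is the monic one, as the following two facts confirm.
\<close>

lemma gcd_poly_monic:
  fixes p f :: "'a :: field_gcd poly"
  assumes "f \<noteq> 0"
  shows "lead_coeff (gcd p f) = 1"
proof -
  have "gcd p f \<noteq> 0" using assms by simp
  moreover have "normalize (gcd p f) = gcd p f" by simp
  ultimately have "unit_factor (gcd p f) = 1"
    using unit_factor_normalize[of "gcd p f"] by simp
  then have "unit_factor (lead_coeff (gcd p f)) = 1"
    by (simp add: unit_factor_poly_def one_pCons)
  moreover have "is_unit (lead_coeff (gcd p f))"
    using assms by (simp add: dvd_field_iff)
  ultimately show ?thesis
    using is_unit_unit_factor[of "lead_coeff (gcd p f)"] by simp
qed

lemma gcd_0_monic:
  fixes f :: "'a :: field_gcd poly"
  assumes "lead_coeff f = 1"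
  shows "gcd 0 f = f"
  using assms by (simp add: normalize_poly_eq_map_poly)

definition mod_poly_rel :: "'a :: field_gcd poly \<Rightarrow> ('a poly \<times> 'a poly) set" where
  "mod_poly_rel f = {(u, v). f dvd u - v}"

definition gcd_graph ::
  "'a :: field_gcd poly \<Rightarrow> 'a poly set \<Rightarrow> 'a poly set pair_pre_digraph" where
  "gcd_graph f D =
     \<lparr> pverts = UNIV // mod_poly_rel f,
       parcs = {(U, V). U \<in> UNIV // mod_poly_rel f \<and> V \<in> UNIV // mod_poly_rel f \<and>
                        (\<exists>u\<in>U. \<exists>v\<in>V. gcd (u - v) f \<in> D)} \<rparr>"

lemma equiv_mod_poly_rel: "equiv UNIV (mod_poly_rel f)"
proof (rule equivI)
  show "sym (mod_poly_rel f)"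
    by (auto simp: sym_def mod_poly_rel_def dvd_diff_commute)
  show "trans (mod_poly_rel f)"
  proof (rule transI)
    fix x y z
    assume "(x, y) \<in> mod_poly_rel f" "(y, z) \<in> mod_poly_rel f"
    then have "f dvd (x - y) + (y - z)"
      unfolding mod_poly_rel_def by (intro dvd_add) auto
    then show "(x, z) \<in> mod_poly_rel f" by (simp add: mod_poly_rel_def)
  qed
qed (auto simp: refl_on_def mod_poly_rel_def)

text \<open>Adjacency does not depend on the choice of representatives.\<close>

lemma gcd_graph_adjacent_iff:
  "(mod_poly_rel f `` {u}, mod_poly_rel f `` {v}) \<in> parcs (gcd_graph f D) \<longleftrightarrow> gcd (u - v) f \<in> D"
proof -
  have "gcd (u' - v') f = gcd (u - v) f"
    if "(u, u') \<in> mod_poly_rel f" "(v, v') \<in> mod_poly_rel f" for u' v'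
  proof -
    from that have "f dvd (u - u') - (v - v')"
      unfolding mod_poly_rel_def by (simp only: mem_Collect_eq case_prod_conv dvd_diff)
    then obtain w where w: "(u - u') - (v - v') = f * w" by (rule dvdE)
    have "u - v = ((u - u') - (v - v')) + (u' - v')" by simp
    also have "\<dots> = w * f + (u' - v')" by (simp only: w mult.commute)
    finally have "gcd f (u - v) = gcd f (u' - v')" by (simp only: gcd_add_mult)
    then show ?thesis by (simp only: gcd.commute)
  qed
  then have "(\<exists>u'\<in>mod_poly_rel f `` {u}. \<exists>v'\<in>mod_poly_rel f `` {v}. gcd (u' - v') f \<in> D)
      \<longleftrightarrow> gcd (u - v) f \<in> D"
    using equiv_class_self[OF equiv_mod_poly_rel UNIV_I] by (metis Image_singleton_iff)
  moreover have "mod_poly_rel f `` {w} \<in> UNIV // mod_poly_rel f" for w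
    by (rule quotientI) (rule UNIV_I)
  ultimately show ?thesis
    by (simp only: gcd_graph_def pair_pre_digraph.simps mem_Collect_eq case_prod_conv simp_thms)
qed

lemma finite_quotient_mod_poly_rel:
  fixes f :: "'a :: {field_gcd, finite} poly"
  assumes "f \<noteq> 0"
  shows "finite (UNIV // mod_poly_rel f)"
proof -
  have "finite {p :: 'a poly. degree p \<le> degree f}"
  proof (rule finite_imageD[of "\<lambda>p. restrict (coeff p) {..degree f}"])
    have "(\<lambda>p. restrict (coeff p) {..degree f}) ` {p :: 'a poly. degree p \<le> degree f}
        \<subseteq> PiE {..degree f} (\<lambda>_. UNIV)"
      by (simp add: image_subset_iff restrict_PiE_iff)
    moreover have "finite (PiE {..degree f} (\<lambda>_. UNIV :: 'a set))"
      by (intro finite_PiE) simp_all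
    ultimately show "finite ((\<lambda>p. restrict (coeff p) {..degree f}) ` {p :: 'a poly. degree p \<le> degree f})"
      by (rule finite_subset)
    show "inj_on (\<lambda>p. restrict (coeff p) {..degree f}) {p :: 'a poly. degree p \<le> degree f}"
    proof (rule inj_onI, rule poly_eqI)
      fix p q :: "'a poly" and i
      assume pq: "p \<in> {p. degree p \<le> degree f}" "q \<in> {p. degree p \<le> degree f}"
        and eq: "restrict (coeff p) {..degree f} = restrict (coeff q) {..degree f}"
      show "coeff p i = coeff q i"
      proof (cases "i \<le> degree f")
        case True
        with fun_cong[OF eq, of i] show ?thesis by simp
      next
        case False
        with pq show ?thesis by (simp add: coeff_eq_0)
      qed
    qed
  qed
  moreover have "UNIV // mod_poly_rel f \<subseteq> (\<lambda>p. mod_poly_rel f `` {p}) ` {p. degree p \<le> degree f}"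
  proof
    fix U assume "U \<in> UNIV // mod_poly_rel f"
    then obtain u where U: "U = mod_poly_rel f `` {u}" by (auto elim: quotientE)
    have "(u, u mod f) \<in> mod_poly_rel f"
      by (simp add: mod_poly_rel_def minus_mod_eq_mult_div)
    then have "U = mod_poly_rel f `` {u mod f}"
      using U equiv_class_eq[OF equiv_mod_poly_rel] by blast
    moreover have "degree (u mod f) \<le> degree f"
      using degree_mod_less[OF assms, of u] by auto
    ultimately show "U \<in> (\<lambda>p. mod_poly_rel f `` {p}) ` {p. degree p \<le> degree f}" by blast
  qed
  ultimately show ?thesis by (rule finite_surj)
qed

text \<open>
  If \<open>f\<close> is monic and not in \<open>D\<close>, the gcd-graph is a finite simple graph in the sense of the library, so that
  \<^const>\<open>perfect_graph\<close> has its intended meaning for it.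
\<close>

lemma pair_graph_gcd_graph:
  fixes f :: "'a :: {field_gcd, finite} poly"
  assumes "lead_coeff f = 1" "f \<notin> D"
  shows "pair_graph (gcd_graph f D)"
proof
  have "f \<noteq> 0" using assms(1) by auto
  then show fin: "finite (pverts (gcd_graph f D))"
    by (simp add: gcd_graph_def finite_quotient_mod_poly_rel)
  have sub: "parcs (gcd_graph f D) \<subseteq> pverts (gcd_graph f D) \<times> pverts (gcd_graph f D)"
    by (auto simp: gcd_graph_def)
  then show "finite (parcs (gcd_graph f D))"
    using fin by (meson finite_SigmaI finite_subset)
  show "fst e \<in> pverts (gcd_graph f D)" "snd e \<in> pverts (gcd_graph f D)"
    if "e \<in> parcs (gcd_graph f D)" for e
    using that sub by auto
  show "fst e \<noteq> snd e" if "e \<in> parcs (gcd_graph f D)" for e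
  proof
    assume eq: "fst e = snd e"
    with that sub obtain u where "e = (mod_poly_rel f `` {u}, mod_poly_rel f `` {u})"
      by (cases e) (auto simp: gcd_graph_def elim: quotientE)
    with that have "gcd (u - u) f \<in> D" by (simp only: gcd_graph_adjacent_iff)
    with assms show False using gcd_0_monic[of f] by simp
  qed
  show "symmetric (with_proj (gcd_graph f D))"
    unfolding symmetric_def
  proof (rule symI)
    fix U V assume "(U, V) \<in> arcs_ends (with_proj (gcd_graph f D))"
    then have UV: "(U, V) \<in> parcs (gcd_graph f D)" by simp
    with sub obtain u v where
      eqs: "U = mod_poly_rel f `` {u}" "V = mod_poly_rel f `` {v}"
      by (auto simp: gcd_graph_def elim!: quotientE)
    have "gcd (u - v) f \<in> D" using UV by (simp only: eqs gcd_graph_adjacent_iff)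
    then have "gcd (v - u) f \<in> D" using gcd_neg1[of "u - v" f] by simp
    then show "(V, U) \<in> arcs_ends (with_proj (gcd_graph f D))"
      by (simp add: eqs gcd_graph_adjacent_iff)
  qed
qed

end

theory Submission
  imports Defs
begin

text \<open>
  The graph contains an induced 5-cycle. Such a cycle has no triangle but needs three colours, so a
  perfect graph has none (\<open>not_perfect_graph_if_induced_C5\<close>).

  The cycle is found by prescribing residues. Think of a part \<open>S\<close> of \<open>D\<close> as coordinates and give
  each vertex \<open>i\<close> a colour \<open>c g i\<close> in the field for every \<open>g \<in> S\<close>, and one more colour \<open>b i\<close> for all
  primes of \<open>f\<close> outside of \<open>S\<close>. There are polynomials \<open>x i\<close> such that \<open>g\<close> divides \<open>x i - x j\<close> if
  \<open>c g i = c g j\<close> and is coprime to it otherwise, and such that the gcd with \<open>f\<close> is exactly \<open>g\<close> if \<open>g\<close> is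
  the only coordinate that agrees and \<open>b i \<noteq> b j\<close> (\<open>ex_polys_with_gcd_pattern\<close>). Two vertices
  that agree in two coordinates are not adjacent, because no element of \<open>D\<close> shares factors with two
  distinct elements of \<open>D\<close>; neither are two vertices whose difference is coprime to all of \<open>D\<close>,
  because \<open>D\<close> contains no unit. What remains is to colour the 5-cycle so that the ends of each edge agree in exactly one
  coordinate and the ends of each chord agree in two or in none
  (\<open>not_perfect_gcd_graph_if_pattern\<close>).

  Such colourings exist with only three colours \<open>0\<close>, \<open>1\<close>, \<open>a\<close>, which any field other than the one with
  two elements provides. If \<open>D\<close> has exactly three elements, let the edges of the cycle agree in the
  coordinates 1, 1, 2, 2, 3. In this pattern the outer primes make some chord lie over them alone: a
  3-colouring of the 5-cycle has two colour classes of size two, which are disjoint chords, whereas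
  the two chords that agree in two coordinates share a vertex. This
  would matter if a fourth element of \<open>D\<close> consisted of such primes, so for larger \<open>D\<close> four elements
  serve as coordinates, with edges of type 1, 2, 3, 4, 1; there both chords on which \<open>b\<close> agrees
  already agree in two coordinates.
\<close>

section \<open>Residue patterns\<close>

lemma coprime_smult_add_multiple:
  fixes w g k :: "'a :: field_gcd poly"
  assumes "coprime w g" and "a \<noteq> 0"
  shows "coprime (smult a w + g * k) g"
proof (rule coprimeI)
  fix r assume r: "r dvd smult a w + g * k" "r dvd g"
  then have "r dvd (smult a w + g * k) - g * k" by (intro dvd_diff) auto
  then have "r dvd w" using assms(2) by (simp add: dvd_smult_iff)
  with r assms(1) show "is_unit r" by (metis coprime_common_divisor)
qed

lemma not_coprime_common_prime:
  fixes g h :: "'a :: factorial_semiring_gcd"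
  assumes "\<not> coprime g h" and "h \<noteq> 0"
  obtains p where "prime p" "p dvd g" "p dvd h"
proof -
  have "\<not> is_unit (gcd g h)" using assms(1) by (simp add: coprime_iff_gcd_eq_1)
  moreover have "gcd g h \<noteq> 0" using assms(2) by simp
  ultimately obtain p where "prime p" "p dvd gcd g h" using prime_divisor_exists by blast
  then show ?thesis using that by simp
qed

text \<open>
  The polynomials are given by a formula. Put \<open>W = \<Prod>S\<close>, let \<open>\<rho>\<close> be the product of the primes of \<open>f\<close> outside
  of \<open>W\<close>, and let \<open>e g\<close> be \<open>\<rho>\<close> times the squares of the elements of \<open>S\<close> other than \<open>g\<close>. Then take
  \<open>x i = b i W + (\<Sum>g. c g i e g)\<close>. Modulo \<open>g\<close> only the summand of \<open>e g\<close> survives, and it is a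
  unit times the difference of the \<open>g\<close>-colours. If these agree, then, since every other \<open>e h\<close> is
  divisible by \<open>g\<^sup>2\<close>, the cofactor of \<open>g\<close> in \<open>x i - x j\<close> is \<open>b i - b j\<close> times a unit modulo \<open>g\<close>; so
  \<open>x i - x j\<close> takes no further factor of \<open>f\<close> from the primes of \<open>g\<close>. Modulo a prime of \<open>\<rho>\<close> only the
  summand of \<open>W\<close> survives.
\<close>

lemma ex_polys_with_gcd_pattern:
  fixes f :: "'a :: field_gcd poly" and S :: "'a poly set"
    and b :: "'i \<Rightarrow> 'a" and c :: "'a poly \<Rightarrow> 'i \<Rightarrow> 'a"
  assumes f: "f \<noteq> 0" and fin: "finite S"
    and cop: "\<And>g h. g \<in> S \<Longrightarrow> h \<in> S \<Longrightarrow> g \<noteq> h \<Longrightarrow> coprime g h"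
  obtains x :: "'i \<Rightarrow> 'a poly" where
    "\<And>g i j. g \<in> S \<Longrightarrow> c g i = c g j \<Longrightarrow> g dvd x i - x j"
    "\<And>g i j. g \<in> S \<Longrightarrow> c g i \<noteq> c g j \<Longrightarrow> coprime (x i - x j) g"
    "\<And>h i j. b i \<noteq> b j \<Longrightarrow> h dvd f \<Longrightarrow> (\<And>g. g \<in> S \<Longrightarrow> coprime g h) \<Longrightarrow> coprime (x i - x j) h"
    "\<And>g i j. g \<in> S \<Longrightarrow> g dvd f \<Longrightarrow> b i \<noteq> b j \<Longrightarrow>
       (\<And>h. h \<in> S \<Longrightarrow> c h i = c h j \<longleftrightarrow> h = g) \<Longrightarrow> gcd (x i - x j) f = normalize g"
proof -
  define W where "W = \<Prod>S"
  define P where "P = {p \<in> prime_factors f. \<not> p dvd W}"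
  define \<rho> where "\<rho> = \<Prod>P"
  define e where "e g = \<rho> * (\<Prod>h\<in>S - {g}. h * h)" for g
  define x where "x i = smult (b i) W + (\<Sum>h\<in>S. smult (c h i) (e h))" for i

  have W_split: "W = g * \<Prod>(S - {g})" if "g \<in> S" for g
    using that fin unfolding W_def by (simp add: prod.remove)
  have cop_rest: "coprime (\<Prod>(S - {g})) g" if "g \<in> S" for g
    using that cop by (intro prod_coprime_left) auto
  have cop_\<rho>: "coprime \<rho> g" if "g \<in> S" for g
    unfolding \<rho>_def
  proof (rule prod_coprime_left)
    fix p assume "p \<in> P"
    then have "prime p" "\<not> p dvd g" using W_split[OF that] by (auto simp: P_def dvd_mult2)
    then show "coprime p g" by (simp add: prime_imp_coprime)
  qed
  have p_\<rho>: "p dvd \<rho>" if "prime p" "p dvd f" "\<not> p dvd W" for p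
  proof -
    have "finite P" by (simp add: P_def del: in_prime_factors_iff)
    moreover have "p \<in> P" using that f by (simp add: P_def in_prime_factors_iff)
    ultimately show ?thesis unfolding \<rho>_def by (rule dvd_prodI[where f = "\<lambda>p. p"])
  qed
  have cop_e: "coprime (e g) g" if "g \<in> S" for g
  proof -
    have "coprime (\<Prod>h\<in>S - {g}. h * h) g"
      using that cop by (intro prod_coprime_left) auto
    with cop_\<rho>[OF that] show ?thesis by (simp add: e_def)
  qed
  have sq_dvd_e: "g * g dvd e h" if "g \<in> S" "h \<noteq> g" for g h
    unfolding e_def using that fin by (intro dvd_mult dvd_prodI) auto

  have diff: "x i - x j = smult (b i - b j) W + (\<Sum>h\<in>S. smult (c h i - c h j) (e h))" for i j
    by (simp add: x_def smult_diff_left sum_subtractf algebra_simps)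
  have split: "\<exists>k. x i - x j = smult (c g i - c g j) (e g)
      + g * (smult (b i - b j) (\<Prod>(S - {g})) + g * k)" if g: "g \<in> S" for g i j
  proof -
    have "g * g dvd (\<Sum>h\<in>S - {g}. smult (c h i - c h j) (e h))"
      using g by (intro dvd_sum dvd_smult sq_dvd_e) auto
    then obtain k where k: "(\<Sum>h\<in>S - {g}. smult (c h i - c h j) (e h)) = g * g * k" by blast
    have "x i - x j = smult (b i - b j) (g * \<Prod>(S - {g}))
        + (smult (c g i - c g j) (e g) + g * g * k)"
      unfolding diff sum.remove[OF fin g] k using W_split[OF g] by simp
    then show ?thesis by (intro exI[of _ k]) (simp add: algebra_simps)
  qed
  have no_outer_prime: "\<not> p dvd x i - x j"
    if p: "prime p" "p dvd f" "\<not> p dvd W" and "b i \<noteq> b j" for p i j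
  proof
    assume "p dvd x i - x j"
    moreover have "p dvd (\<Sum>h\<in>S. smult (c h i - c h j) (e h))"
      using p_\<rho>[OF p] by (intro dvd_sum dvd_smult) (simp add: e_def)
    ultimately have "p dvd smult (b i - b j) W" unfolding diff by (simp add: dvd_add_left_iff)
    with \<open>b i \<noteq> b j\<close> p show False by (simp add: dvd_smult_iff)
  qed

  have 1: "g dvd x i - x j" if g: "g \<in> S" "c g i = c g j" for g i j
    using split[OF g(1), of i j] g(2) by auto
  have 2: "coprime (x i - x j) g" if g: "g \<in> S" "c g i \<noteq> c g j" for g i j
  proof -
    obtain k where "x i - x j = smult (c g i - c g j) (e g) + g * k"
      using split[OF g(1), of i j] by blast
    with g cop_e show ?thesis by (simp add: coprime_smult_add_multiple)
  qed
  have 3: "coprime (x i - x j) h"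
    if b: "b i \<noteq> b j" and h: "h dvd f" and cop_h: "\<And>g. g \<in> S \<Longrightarrow> coprime g h" for h i j
  proof (rule ccontr)
    assume "\<not> coprime (x i - x j) h"
    moreover have "h \<noteq> 0" using h f by auto
    ultimately obtain p where p: "prime p" "p dvd x i - x j" "p dvd h"
      by (rule not_coprime_common_prime)
    have "coprime W h" unfolding W_def using cop_h by (intro prod_coprime_left)
    then have "\<not> p dvd W" using p by (metis coprime_common_divisor not_prime_unit)
    with no_outer_prime[of p i j] p b h show False by (meson dvd_trans)
  qed
  have 4: "gcd (x i - x j) f = normalize g"
    if g: "g \<in> S" "g dvd f" and b: "b i \<noteq> b j"
      and c: "\<And>h. h \<in> S \<Longrightarrow> c h i = c h j \<longleftrightarrow> h = g" for g i j
  proof -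
    obtain k where k: "x i - x j = g * (smult (b i - b j) (\<Prod>(S - {g})) + g * k)"
      using split[OF g(1), of i j] c[OF g(1)] by auto
    define d where "d = smult (b i - b j) (\<Prod>(S - {g})) + g * k"
    have cop_dg: "coprime d g"
      unfolding d_def using b by (intro coprime_smult_add_multiple cop_rest g) auto
    have "coprime d f"
    proof (rule ccontr)
      assume "\<not> coprime d f"
      then obtain p where p: "prime p" "p dvd d" "p dvd f"
        using f by (rule not_coprime_common_prime)
      have pd: "p dvd x i - x j" using p k unfolding d_def by auto
      then have "p dvd W" using no_outer_prime p b by blast
      then obtain h where h: "h \<in> S" "p dvd h"
        using fin p(1) unfolding W_def by (auto simp: prime_dvd_prod_iff)
      show False
      proof (cases "h = g")
        case True
        with cop_dg p h show False by (metis coprime_common_divisor not_prime_unit)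
      next
        case False
        with c h have "coprime (x i - x j) h" by (intro 2) auto
        with pd p h show False by (metis coprime_common_divisor not_prime_unit)
      qed
    qed
    then have "gcd (g * d) f = gcd g f"
      by (metis gcd_mult_right_right_cancel gcd.commute coprime_commute)
    also have "\<dots> = normalize g" using g by (simp add: gcd_proj1_iff)
    finally show ?thesis using k unfolding d_def by simp
  qed
  show ?thesis using that[of x] 1 2 3 4 by blast
qed

section \<open>Perfect graphs have no induced five-cycle\<close>

lemma All_less_5: "(\<forall>i<5::nat. P i) \<longleftrightarrow> P 0 \<and> P 1 \<and> P 2 \<and> P 3 \<and> P 4"
  by (auto simp: numeral_eq_Suc All_less_Suc)

lemma dominates_induce_subgraph_iff:
  "u \<rightarrow>\<^bsub>G \<restriction> V\<^esub> v \<longleftrightarrow> u \<rightarrow>\<^bsub>G\<^esub> v \<and> u \<in> V \<and> v \<in> V"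
  by (auto simp: arcs_ends_def arc_to_ends_def image_iff)

lemma not_perfect_graph_if_induced_C5:
  fixes v :: "nat \<Rightarrow> 'v"
  assumes "graph G"
    and verts: "\<And>i. i < 5 \<Longrightarrow> v i \<in> verts G"
    and edge: "\<And>i. i < 5 \<Longrightarrow> v i \<rightarrow>\<^bsub>G\<^esub> v ((i + 1) mod 5)"
    and chord: "\<And>i. i < 5 \<Longrightarrow> \<not> v i \<rightarrow>\<^bsub>G\<^esub> v ((i + 2) mod 5)"
  shows "\<not> perfect_graph G"
proof
  interpret graph G by fact
  assume perfect: "perfect_graph G"
  define V where "V = v ` {..<5}"
  define H where "H = G \<restriction> V"
  have V_eq: "V = {v 0, v 1, v 2, v 3, v 4}"
    by (auto simp: V_def numeral_eq_Suc lessThan_Suc)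
  have sub: "V \<subseteq> verts G" using verts by (auto simp: V_def)
  have ind: "induced_subgraph H G" unfolding H_def using sub by (rule induced_induce)
  have H_iff: "u \<rightarrow>\<^bsub>H\<^esub> w \<longleftrightarrow> u \<rightarrow>\<^bsub>G\<^esub> w \<and> u \<in> V \<and> w \<in> V" for u w
    unfolding H_def by (rule dominates_induce_subgraph_iff)
  have edges: "v 0 \<rightarrow>\<^bsub>G\<^esub> v 1" "v 1 \<rightarrow>\<^bsub>G\<^esub> v 2" "v 2 \<rightarrow>\<^bsub>G\<^esub> v 3" "v 3 \<rightarrow>\<^bsub>G\<^esub> v 4" "v 4 \<rightarrow>\<^bsub>G\<^esub> v 0"
    using edge[of 0] edge[of 1] edge[of 2] edge[of 3] edge[of 4] by (simp_all add: numeral_2_eq_2)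
  have chords: "\<not> v 0 \<rightarrow>\<^bsub>G\<^esub> v 2" "\<not> v 1 \<rightarrow>\<^bsub>G\<^esub> v 3" "\<not> v 2 \<rightarrow>\<^bsub>G\<^esub> v 4" "\<not> v 3 \<rightarrow>\<^bsub>G\<^esub> v 0" "\<not> v 4 \<rightarrow>\<^bsub>G\<^esub> v 1"
    using chord[of 0] chord[of 1] chord[of 2] chord[of 3] chord[of 4] by (simp_all add: numeral_2_eq_2)
  have sym: "w \<rightarrow>\<^bsub>G\<^esub> u" if "u \<rightarrow>\<^bsub>G\<^esub> w" for u w using that by (rule graph_symmetric)
  have irrefl: "\<not> u \<rightarrow>\<^bsub>G\<^esub> u" for u using adj_not_same by blast

  have "card K \<le> 2" if K: "clique H K" for K
  proof (rule ccontr)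
    assume "\<not> card K \<le> 2"
    then obtain T where T: "T \<subseteq> K" "card T = 3"
      by (metis not_less_eq_eq numeral_2_eq_2 numeral_3_eq_3 obtain_subset_with_card_n)
    then obtain p q r where pqr: "T = {p, q, r}" "p \<noteq> q" "q \<noteq> r" "p \<noteq> r"
      by (auto simp: card_3_iff)
    have "p \<in> V" "q \<in> V" "r \<in> V"
      using pqr T K unfolding clique_def H_def by auto
    moreover have "p \<rightarrow>\<^bsub>G\<^esub> q" "q \<rightarrow>\<^bsub>G\<^esub> r" "p \<rightarrow>\<^bsub>G\<^esub> r"
      using pqr T K unfolding clique_def H_iff by auto
    ultimately show False
      using chords sym irrefl unfolding V_eq by (elim insertE emptyE) metis+
  qed
  moreover have "{K. clique H K} \<subseteq> Pow V" by (auto simp: clique_def H_def)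
  then have "finite {K. clique H K}" by (rule finite_subset) (simp add: V_def)
  moreover have "clique H {}" by (simp add: clique_def)
  ultimately have "clique_number H \<le> 2"
    unfolding clique_number_def by (subst Max_le_iff) auto
  then have chi: "chromatic_number H \<le> 2"
    using perfect ind unfolding perfect_graph_def by simp

  \<comment> \<open>Any proper colouring makes the least number in \<open>chromatic_number\<close> an attained one.\<close>
  obtain c n where "inj_on (c :: 'v \<Rightarrow> nat) V" "c ` V = {i. i < (n :: nat)}"
    using finite_imp_inj_to_nat_seg[of V] by (auto simp: V_def)
  then have "proper_colouring H c n"
    unfolding proper_colouring_def H_iff using irrefl
    by (auto simp: H_def inj_on_def)
  then have "\<exists>c. proper_colouring H c (chromatic_number H)"
    unfolding chromatic_number_def by (intro LeastI[of "\<lambda>k. \<exists>c. proper_colouring H c k"]) blast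
  then obtain c where c: "proper_colouring H c (chromatic_number H)" ..
  have "c (v i) < 2" if "i < 5" for i
    using c chi that unfolding proper_colouring_def by (force simp: H_def V_def)
  from this[of 0] this[of 1] this[of 2] this[of 3] this[of 4]
  have "c (v 0) < 2" "c (v 1) < 2" "c (v 2) < 2" "c (v 3) < 2" "c (v 4) < 2" by simp_all
  moreover have "c u \<noteq> c w" if "u \<rightarrow>\<^bsub>G\<^esub> w" "u \<in> V" "w \<in> V" for u w
    using c that unfolding proper_colouring_def H_iff by blast
  then have "c (v 0) \<noteq> c (v 1)" "c (v 1) \<noteq> c (v 2)" "c (v 2) \<noteq> c (v 3)" "c (v 3) \<noteq> c (v 4)"
    "c (v 4) \<noteq> c (v 0)"
    using edges unfolding V_eq by auto
  ultimately show False by linarith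
qed

section \<open>Induced five-cycles in the gcd-graph\<close>

text \<open>
  A chord on which no coordinate agrees is coprime to \<open>S\<close>. The colours \<open>b\<close> must differ on it only
  if \<open>D\<close> has further elements, which the difference could otherwise have as its gcd with \<open>f\<close>.
\<close>

lemma not_perfect_gcd_graph_if_pattern:
  fixes f :: "'a :: {field_gcd, finite} poly" and D S :: "'a poly set"
    and b :: "nat \<Rightarrow> 'a" and c :: "'a poly \<Rightarrow> nat \<Rightarrow> 'a"
  assumes f: "lead_coeff f = 1" "f \<notin> D"
    and monic_div: "\<And>d. d \<in> D \<Longrightarrow> d dvd f \<and> lead_coeff d = 1"
    and deg: "\<And>d. d \<in> D \<Longrightarrow> degree d \<ge> 1"
    and cop: "\<And>d e. d \<in> D \<Longrightarrow> e \<in> D \<Longrightarrow> d \<noteq> e \<Longrightarrow> gcd d e = 1"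
    and S: "finite S" "S \<subseteq> D"
    and edge: "\<And>i. i < 5 \<Longrightarrow> b i \<noteq> b ((i + 1) mod 5) \<and>
      (\<exists>g\<in>S. \<forall>h\<in>S. c h i = c h ((i + 1) mod 5) \<longleftrightarrow> h = g)"
    and chord: "\<And>i. i < 5 \<Longrightarrow>
      (\<exists>g\<in>S. \<exists>h\<in>S. g \<noteq> h \<and> c g i = c g ((i + 2) mod 5) \<and> c h i = c h ((i + 2) mod 5)) \<or>
      (\<forall>h\<in>S. c h i \<noteq> c h ((i + 2) mod 5)) \<and> (S = D \<or> b i \<noteq> b ((i + 2) mod 5))"
  shows "\<not> perfect_graph (with_proj (gcd_graph f D))"
proof -
  have "f \<noteq> 0" using f by auto
  have nonunit: "\<not> is_unit d" if "d \<in> D" for d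
    using deg[OF that] monic_div[OF that] is_unit_iff_degree[of d] by fastforce
  have D_gcd: "gcd d f \<notin> D" if "g \<in> D" "h \<in> D" "g \<noteq> h" "g dvd d" "h dvd d" for d g h
  proof
    assume D: "gcd d f \<in> D"
    have "g dvd gcd d f" "h dvd gcd d f" using that monic_div by auto
    then have "gcd g (gcd d f) \<noteq> 1" "gcd h (gcd d f) \<noteq> 1"
      using nonunit that by (metis coprime_iff_gcd_eq_1 coprime_absorb_left)+
    then have "g = gcd d f" "h = gcd d f" using cop D that by blast+
    with that show False by simp
  qed
  have D_coprime: "gcd d f \<notin> D" if "\<And>h. h \<in> D \<Longrightarrow> coprime d h" for d
    using that nonunit by (metis coprime_absorb_right gcd_dvd1 coprime_commute)
  have cop_S: "coprime g h" if "g \<in> S" "h \<in> D" "g \<noteq> h" for g h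
    using that S cop by (auto simp: coprime_iff_gcd_eq_1)
  obtain x :: "nat \<Rightarrow> 'a poly" where x:
    "\<And>g i j. g \<in> S \<Longrightarrow> c g i = c g j \<Longrightarrow> g dvd x i - x j"
    "\<And>g i j. g \<in> S \<Longrightarrow> c g i \<noteq> c g j \<Longrightarrow> coprime (x i - x j) g"
    "\<And>h i j. b i \<noteq> b j \<Longrightarrow> h dvd f \<Longrightarrow> (\<And>g. g \<in> S \<Longrightarrow> coprime g h) \<Longrightarrow> coprime (x i - x j) h"
    "\<And>g i j. g \<in> S \<Longrightarrow> g dvd f \<Longrightarrow> b i \<noteq> b j \<Longrightarrow>
       (\<And>h. h \<in> S \<Longrightarrow> c h i = c h j \<longleftrightarrow> h = g) \<Longrightarrow> gcd (x i - x j) f = normalize g"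
    by (rule ex_polys_with_gcd_pattern[OF \<open>f \<noteq> 0\<close> S(1), where b = b and c = c]) (use cop_S S in blast)+
  define v where "v i = mod_poly_rel f `` {x i}" for i
  have adj: "v i \<rightarrow>\<^bsub>with_proj (gcd_graph f D)\<^esub> v j \<longleftrightarrow> gcd (x i - x j) f \<in> D" for i j
    unfolding v_def by (simp add: gcd_graph_adjacent_iff)
  interpret pair_graph "gcd_graph f D" using f by (rule pair_graph_gcd_graph)
  show ?thesis
  proof (rule not_perfect_graph_if_induced_C5)
    show "graph (with_proj (gcd_graph f D))" by unfold_locales
    show "v i \<in> verts (with_proj (gcd_graph f D))" for i
      by (simp add: v_def gcd_graph_def quotientI)
  next
    fix i :: nat assume i: "i < 5"
    from edge[OF i] obtain g where g: "g \<in> S" "b i \<noteq> b ((i + 1) mod 5)"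
      "\<And>h. h \<in> S \<Longrightarrow> c h i = c h ((i + 1) mod 5) \<longleftrightarrow> h = g" by blast
    then have "g \<in> D" using S by blast
    then have "gcd (x i - x ((i + 1) mod 5)) f = normalize g"
      using g monic_div by (intro x(4)) auto
    also have "normalize g = g" using monic_div[OF \<open>g \<in> D\<close>] gcd_0_monic[of g] by simp
    finally show "v i \<rightarrow>\<^bsub>with_proj (gcd_graph f D)\<^esub> v ((i + 1) mod 5)"
      using \<open>g \<in> D\<close> by (simp only: adj)
  next
    fix i :: nat assume i: "i < 5"
    let ?j = "(i + 2) mod 5"
    from chord[OF i] have "gcd (x i - x ?j) f \<notin> D"
    proof (elim disjE bexE conjE)
      fix g h assume "g \<in> S" "h \<in> S" "g \<noteq> h" "c g i = c g ?j" "c h i = c h ?j"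
      then show ?thesis using S by (intro D_gcd[of g h] x(1)) auto
    next
      assume "\<forall>h\<in>S. c h i \<noteq> c h ?j" "S = D"
      then show ?thesis by (intro D_coprime x(2)) auto
    next
      assume c: "\<forall>h\<in>S. c h i \<noteq> c h ?j" and b: "b i \<noteq> b ?j"
      show ?thesis
      proof (rule D_coprime)
        fix h assume h: "h \<in> D"
        show "coprime (x i - x ?j) h"
        proof (cases "h \<in> S")
          case True
          with c show ?thesis by (intro x(2)) auto
        next
          case False
          with h b cop_S monic_div show ?thesis by (intro x(3)) auto
        qed
      qed
    qed
    then show "\<not> v i \<rightarrow>\<^bsub>with_proj (gcd_graph f D)\<^esub> v ?j" by (simp only: adj not_False_eq_True)
  qed
qed

theorem proposition7p4:
  fixes f :: "'a :: {field_gcd, finite} poly" and D :: "'a poly set"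
  assumes "f \<noteq> 0" and "lead_coeff f = 1"
    and "\<And>d. d \<in> D \<Longrightarrow> d dvd f \<and> lead_coeff d = 1"
    and "\<And>d. d \<in> D \<Longrightarrow> degree d \<ge> 1"
    and "\<And>d e. d \<in> D \<Longrightarrow> e \<in> D \<Longrightarrow> d \<noteq> e \<Longrightarrow> gcd d e = 1"
    and "card D \<ge> 3"
    and "CARD('a) \<noteq> 2"
  shows "\<not> perfect_graph (with_proj (gcd_graph f D))"
proof -
  have "f \<notin> D"
  proof
    assume "f \<in> D"
    have "D \<noteq> {f}" using assms(6) by auto
    with \<open>f \<in> D\<close> obtain d where "d \<in> D" "d \<noteq> f" by blast
    then have "gcd d f = 1" "d dvd f" using assms(3,5) \<open>f \<in> D\<close> by blast+
    then have "is_unit d" by (metis gcd_greatest dvd_refl)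
    then show False using assms(3,4)[OF \<open>d \<in> D\<close>] is_unit_iff_degree[of d] by fastforce
  qed
  note pattern = not_perfect_gcd_graph_if_pattern[OF assms(2) this, OF assms(3-5)]

  have "\<exists>a::'a. a \<noteq> 0 \<and> a \<noteq> 1"
  proof (rule ccontr)
    assume "\<not> ?thesis"
    then have "UNIV = {0, 1 :: 'a}" by auto
    then have "CARD('a) = card {0, 1 :: 'a}" by simp
    with assms(7) show False by simp
  qed
  then obtain a :: 'a where a: "a \<noteq> 0" "a \<noteq> 1" "0 \<noteq> a" "1 \<noteq> a" by metis
  \<comment> \<open>A proper colouring of the cycle whose two monochromatic chords are 0--2 and 1--4.\<close>
  define b where "b = (!) [0, 1, 0, a, 1]"

  obtain g1 g2 g3 where g: "{g1, g2, g3} \<subseteq> D" "g1 \<noteq> g2" "g2 \<noteq> g3" "g1 \<noteq> g3"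
    using obtain_subset_with_card_n[OF assms(6)] by (metis card_3_iff)
  note g = g g(2-4)[symmetric]
  show ?thesis
  proof (cases "D = {g1, g2, g3}")
    case True
    \<comment> \<open>The chords 0--2 and 2--4 agree in the coordinates 1, 3 and 2, 3, the other chords in none.\<close>
    define c where "c g = (!) (if g = g1 then [0, 0, 0, 1, a] else
      if g = g2 then [1, a, 0, 0, 0] else [0, 1, 0, a, 0])" for g
    have edges: "\<forall>i<5. b i \<noteq> b ((i + 1) mod 5) \<and>
      (\<exists>g\<in>D. \<forall>h\<in>D. c h i = c h ((i + 1) mod 5) \<longleftrightarrow> h = g)"
      unfolding All_less_5 True using a g by (simp add: b_def c_def)
    have chords: "\<forall>i<5. (\<exists>g\<in>D. \<exists>h\<in>D. g \<noteq> h \<and>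
          c g i = c g ((i + 2) mod 5) \<and> c h i = c h ((i + 2) mod 5)) \<or>
        (\<forall>h\<in>D. c h i \<noteq> c h ((i + 2) mod 5))"
      unfolding All_less_5 True using a g by (simp add: c_def)
    have "finite D" unfolding True by simp
    show ?thesis
      by (rule pattern[of D b c]) (use \<open>finite D\<close> edges chords in blast)+
  next
    case False
    then obtain g4 where g4: "g4 \<in> D" "g4 \<noteq> g1" "g4 \<noteq> g2" "g4 \<noteq> g3" using g by blast
    note g = g g4(2-4) g4(2-4)[symmetric]
    define S where "S = {g1, g2, g3, g4}"
    \<comment> \<open>The chords 0--2, 0--3, 1--4 agree in the coordinates 3, 4 and 2, 3 and 1, 3, the chords
      1--3 and 2--4 in none.\<close>
    define c where "c g = (!) (if g = g1 then [0, 0, 1, a, 0] else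
      if g = g2 then [0, 1, 1, 0, a] else
      if g = g3 then [0, 1, 0, 0, 1] else [0, 1, 0, a, a])" for g
    have edges: "\<forall>i<5. b i \<noteq> b ((i + 1) mod 5) \<and>
      (\<exists>g\<in>S. \<forall>h\<in>S. c h i = c h ((i + 1) mod 5) \<longleftrightarrow> h = g)"
      unfolding All_less_5 S_def using a g by (simp add: b_def c_def)
    have chords: "\<forall>i<5. (\<exists>g\<in>S. \<exists>h\<in>S. g \<noteq> h \<and>
          c g i = c g ((i + 2) mod 5) \<and> c h i = c h ((i + 2) mod 5)) \<or>
        (\<forall>h\<in>S. c h i \<noteq> c h ((i + 2) mod 5)) \<and> b i \<noteq> b ((i + 2) mod 5)"
      unfolding All_less_5 S_def using a g by (simp add: b_def c_def)
    have S: "finite S" "S \<subseteq> D" using g(1) g4(1) by (auto simp: S_def)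
    show ?thesis
      by (rule pattern[of S b c]) (use S edges chords in blast)+
  qed
qed

end
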